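(* Let $R$ be a unique factorization domain with quotient field $Q(R)$, let $f(s)=\frac{a_m}{m^s}+\cdots+\frac{a_n}{n^s}$ be an algebraically primitive Dirichlet polynomial with coefficients in $R$, $a_ma_n\neq0$, and let $p$ be a prime element of $R$. Suppose that $p\nmid a_k$ for some index $k<m\,\delta(m,n)$, that $p\mid a_j$ for all $j\ge m\,\delta(m,n)$, and that $$\rho(m,n)<\left(\frac{n}{i}\right)^{\frac{1}{\nu_p(a_n)-\nu_p(a_i)}}\quad\text{for all } i<n \text{ with } \nu_p(a_i)<\nu_p(a_n).$$ Then for any nonzero elements $b_m,\dots,b_n\in R$ with $p\nmid b_kb_n$, the Dirichlet polynomial $g(s)=\frac{a_mb_m}{m^s}+\cdots+\frac{a_nb_n}{n^s}$ is irreducible over $Q(R)$.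
   Context: Dirichlet polynomials are multiplied by the Dirichlet product $\left(\sum_j\frac{b_j}{j^s}\right)\left(\sum_k\frac{c_k}{k^s}\right)=\sum_i\frac{\sum_{jk=i}b_jc_k}{i^s}$; constant means supported on $\{1\}$; algebraically primitive means the indices with nonzero coefficient have gcd $1$. $\nu_p$ is the $p$-adic valuation with $\nu_p(0)=+\infty$. For integers $1\le m<n$: $\rho(m,n)=\max\{\frac dc: d\mid n,\ c\mid m,\ \frac dc\le\sqrt{n/m}\}$ and $\delta(m,n)=\min\{\frac dc: d\mid n,\ c\mid m,\ d>c>0\}$. Irreducible over $Q(R)$: not a product of two nonconstant Dirichlet polynomials with coefficients in $Q(R)$. *)

theory Defs
  imports Complex_Main "HOL-Library.Extended_Nat"
    "HOL-Computational_Algebra.Computational_Algebra"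
begin

text \<open>
  A Dirichlet polynomial \<open>\<Sum>\<^sub>i a\<^sub>i / i\<^sup>s\<close> is a formal object, given by its coefficient function
  \<open>a\<close>. Indices are positive, so the value at \<open>0\<close> is required to vanish.
\<close>

definition dsupp :: "(nat \<Rightarrow> 'c::zero) \<Rightarrow> nat set" where
  "dsupp a = {i. a i \<noteq> 0}"

definition dirichlet_poly :: "(nat \<Rightarrow> 'c::zero) \<Rightarrow> bool" where
  "dirichlet_poly a \<longleftrightarrow> finite (dsupp a) \<and> 0 \<notin> dsupp a"

definition dconstant :: "(nat \<Rightarrow> 'c::zero) \<Rightarrow> bool" where
  "dconstant a \<longleftrightarrow> dsupp a \<subseteq> {1}"

definition dirichlet_mult ::
  "(nat \<Rightarrow> 'c::comm_semiring_0) \<Rightarrow> (nat \<Rightarrow> 'c) \<Rightarrow> nat \<Rightarrow> 'c" where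
  "dirichlet_mult b c i = (\<Sum>(j, k) \<in> {(j, k). 0 < j \<and> 0 < k \<and> j * k = i}. b j * c k)"

definition algebraically_primitive :: "(nat \<Rightarrow> 'c::zero) \<Rightarrow> bool" where
  "algebraically_primitive a \<longleftrightarrow> Gcd (dsupp a) = 1"

definition irreducible_over_quotient_field :: "(nat \<Rightarrow> 'a::idom) \<Rightarrow> bool" where
  "irreducible_over_quotient_field g \<longleftrightarrow>
     \<not> (\<exists>u v :: nat \<Rightarrow> 'a fract.
          dirichlet_poly u \<and> dirichlet_poly v \<and> \<not> dconstant u \<and> \<not> dconstant v \<and>
          (\<lambda>i. to_fract (g i)) = dirichlet_mult u v)"

text \<open>The constant \<open>multiplicity\<close> assigns \<open>0\<close> to the zero element, hence the case distinction.\<close>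

definition nu :: "'a::factorial_semiring \<Rightarrow> 'a \<Rightarrow> enat" where
  "nu p x = (if x = 0 then \<infinity> else enat (multiplicity p x))"

text \<open>For \<open>1 \<le> m < n\<close> both sets below are finite and nonempty: divisors are positive, the first
  set contains \<open>1 / 1\<close> and the second one \<open>n / m\<close>.\<close>

definition rho :: "nat \<Rightarrow> nat \<Rightarrow> real" where
  "rho m n = Max {real d / real c | d c.
     d dvd n \<and> c dvd m \<and> real d / real c \<le> sqrt (real n / real m)}"

definition delta :: "nat \<Rightarrow> nat \<Rightarrow> real" where
  "delta m n = Min {real d / real c | d c. d dvd n \<and> c dvd m \<and> d > c \<and> c > 0}"

end

theory Submission
  imports Defs
begin

text \<open>
  Suppose \<open>g = u v\<close>, with supports spanning \<open>{m\<^sub>1..n\<^sub>1}\<close> and \<open>{m\<^sub>2..n\<^sub>2}\<close>. Then \<open>m\<^sub>1 m\<^sub>2 = m\<close> and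
  \<open>n\<^sub>1 n\<^sub>2 = n\<close>, and we may choose \<open>u\<close> with \<open>n\<^sub>1 / m\<^sub>1 \<le> sqrt (n / m)\<close>, hence \<open>n\<^sub>1 / m\<^sub>1 \<le> \<rho>(m, n)\<close>;
  primitivity gives \<open>m\<^sub>1 < n\<^sub>1\<close>. Consider the \<open>p\<close>-adic Newton polygon with vertices over \<open>ln i\<close>.
  The hypothesis on \<open>\<rho>\<close> says that all slopes of the polygon of \<open>g\<close> are less than
  \<open>1 / ln (n\<^sub>1 / m\<^sub>1)\<close>, and the factor \<open>u\<close> inherits this bound. Since the polygon of \<open>u\<close> has width
  \<open>ln (n\<^sub>1 / m\<^sub>1)\<close>, the valuation of \<open>u\<close> rises by less than \<open>1\<close> towards its last coefficient, which
  therefore has minimal valuation. If \<open>j\<close> is the largest index at which \<open>v\<close> has minimal valuation,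
  then the coefficient of \<open>g\<close> at \<open>n\<^sub>1 j\<close> has minimal valuation \<open>0\<close>; but
  \<open>n\<^sub>1 j \<ge> n\<^sub>1 m\<^sub>2 = m (n\<^sub>1 / m\<^sub>1) \<ge> m \<delta>(m, n)\<close>, where \<open>p\<close> divides all coefficients.
\<close>

section \<open>Index pairs, Dirichlet products and lexicographic minima\<close>

text \<open>Multiplication is strictly monotone on positive numbers. This is how an extreme pair of
  indices is recognised as the only one with its product.\<close>

lemma mult_eq_mult_le_imp_eq:
  fixes i j i' j' :: nat
  assumes "i \<le> i'" "j \<le> j'" "i * j = i' * j'" "0 < i" "0 < j"
  shows "i = i' \<and> j = j'"
proof -
  have "i * j \<le> i * j'" "i * j' \<le> i' * j'"
    using assms(1,2) by simp_all
  with assms(3) have "i * j = i * j'" "i * j' = i' * j'"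
    by linarith+
  then show ?thesis
    using assms(2,4,5) by simp
qed

lemma finite_factor_pairs: "finite {(j, k). 0 < j \<and> 0 < k \<and> j * k = (i::nat)}"
proof (rule finite_subset)
  show "{(j, k). 0 < j \<and> 0 < k \<and> j * k = i} \<subseteq> {..i} \<times> {..i}"
    by auto
qed simp

lemma dirichlet_mult_commute: "dirichlet_mult b c = dirichlet_mult c b"
proof
  fix i
  show "dirichlet_mult b c i = dirichlet_mult c b i"
    unfolding dirichlet_mult_def
    by (rule sum.reindex_bij_witness[of _ prod.swap prod.swap]) (auto simp: mult.commute)
qed

lemma dirichlet_mult_nonzeroE:
  assumes "dirichlet_mult b c i \<noteq> 0"
  obtains j k where "b j \<noteq> 0" "c k \<noteq> 0" "j * k = i"
proof -
  have "\<exists>x\<in>{(j, k). 0 < j \<and> 0 < k \<and> j * k = i}. (case x of (j, k) \<Rightarrow> b j * c k) \<noteq> 0"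
    using assms unfolding dirichlet_mult_def by (meson sum.not_neutral_contains_not_neutral)
  then obtain j k where "b j * c k \<noteq> 0" "j * k = i"
    by auto
  then show thesis
    using that[of j k] by (cases "b j = 0"; cases "c k = 0") auto
qed

text \<open>Minimise \<open>w\<close>, then \<open>t\<close> among the minimisers. The tie-break
  selects the least index of minimal weight or, with a negated index as \<open>t\<close>, the
  largest index of minimal valuation.\<close>

lemma ex_lex_min:
  fixes w :: "'b \<Rightarrow> 'c::linorder" and t :: "'b \<Rightarrow> 'd::linorder"
  assumes "finite S" "S \<noteq> {}"
  obtains x where "x \<in> S" "\<And>y. y \<in> S \<Longrightarrow> w x \<le> w y"
    "\<And>y. y \<in> S \<Longrightarrow> w y = w x \<Longrightarrow> t x \<le> t y"
proof -
  obtain x0 where x0: "x0 \<in> S" "\<forall>y\<in>S. w x0 \<le> w y"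
    using ex_is_arg_min_if_finite[OF assms, of w] by (auto simp: is_arg_min_linorder)
  have "finite {y \<in> S. w y = w x0}" "{y \<in> S. w y = w x0} \<noteq> {}"
    using assms(1) x0(1) by auto
  from ex_is_arg_min_if_finite[OF this, of t]
  obtain x where "x \<in> {y \<in> S. w y = w x0}" "\<forall>y\<in>{y \<in> S. w y = w x0}. t x \<le> t y"
    by (auto simp: is_arg_min_linorder)
  with x0 show thesis
    using that[of x] by auto
qed

section \<open>Valuations of the coefficients of a Dirichlet product\<close>

text \<open>The conclusion is a divisibility because the coefficient may vanish, and
  \<open>multiplicity\<close> would then be 0.\<close>

lemma power_dvd_dirichlet_mult:
  fixes F G :: "nat \<Rightarrow> 'a::{factorial_semiring, idom}"
  assumes "\<And>i j. F i \<noteq> 0 \<Longrightarrow> G j \<noteq> 0 \<Longrightarrow> i * j = l \<Longrightarrow>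
    M \<le> multiplicity p (F i) + multiplicity p (G j)"
  shows "p ^ M dvd dirichlet_mult F G l"
proof -
  have "p ^ M dvd F i * G j" if "i * j = l" for i j
  proof (cases "F i = 0 \<or> G j = 0")
    case False
    then have "M \<le> multiplicity p (F i) + multiplicity p (G j)"
      using assms that by blast
    then have "p ^ M dvd p ^ multiplicity p (F i) * p ^ multiplicity p (G j)"
      unfolding power_add[symmetric] by (rule le_imp_power_dvd)
    also have "\<dots> dvd F i * G j"
      by (intro mult_dvd_mono multiplicity_dvd)
    finally show ?thesis .
  qed auto
  then show ?thesis
    unfolding dirichlet_mult_def by (auto intro!: dvd_sum)
qed

text \<open>This is the equality case of the ultrametric inequality: one summand has strictly
  smallest valuation, and all others are divisible by one further power of \<open>p\<close>.\<close>

lemma dirichlet_mult_isolated_term: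
  fixes F G :: "nat \<Rightarrow> 'a::{factorial_semiring, idom}"
  assumes p: "prime_elem p" and nz: "F i0 \<noteq> 0" "G j0 \<noteq> 0" and pos: "0 < i0" "0 < j0"
    and isolated: "\<And>i j. F i \<noteq> 0 \<Longrightarrow> G j \<noteq> 0 \<Longrightarrow> i * j = i0 * j0 \<Longrightarrow> (i, j) \<noteq> (i0, j0) \<Longrightarrow>
      multiplicity p (F i0) + multiplicity p (G j0) < multiplicity p (F i) + multiplicity p (G j)"
  shows "dirichlet_mult F G (i0 * j0) \<noteq> 0"
    and "multiplicity p (dirichlet_mult F G (i0 * j0)) =
      multiplicity p (F i0) + multiplicity p (G j0)"
proof -
  define M where "M = multiplicity p (F i0) + multiplicity p (G j0)"
  let ?S = "{(j, k). 0 < j \<and> 0 < k \<and> j * k = i0 * j0}"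
  define r where "r = (\<Sum>(j, k)\<in>?S - {(i0, j0)}. F j * G k)"
  have eq: "dirichlet_mult F G (i0 * j0) = F i0 * G j0 + r"
    unfolding dirichlet_mult_def r_def
    using sum.remove[OF finite_factor_pairs, of "(i0, j0)" "i0 * j0" "\<lambda>(j, k). F j * G k"] pos
    by simp
  have M: "multiplicity p (F i0 * G j0) = M"
    unfolding M_def using p nz by (simp add: prime_elem_multiplicity_mult_distrib)
  have nunit: "\<not> is_unit p"
    using p by (simp add: prime_elem_def)
  have r: "p ^ Suc M dvd r"
  proof -
    have "p ^ Suc M dvd F i * G j" if ij: "i * j = i0 * j0" "(i, j) \<noteq> (i0, j0)" for i j
    proof (cases "F i = 0 \<or> G j = 0")
      case False
      then have "multiplicity p (F i * G j) = multiplicity p (F i) + multiplicity p (G j)"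
        using p by (simp add: prime_elem_multiplicity_mult_distrib)
      then have "Suc M \<le> multiplicity p (F i * G j)"
        using isolated[of i j] False ij unfolding M_def by force
      then show ?thesis
        by (rule multiplicity_dvd')
    qed auto
    then show ?thesis
      unfolding r_def by (auto intro!: dvd_sum simp del: power_Suc)
  qed
  have "\<not> p ^ Suc M dvd F i0 * G j0"
    using M nz nunit by (simp add: power_dvd_iff_le_multiplicity del: power_Suc)
  then have ndvd: "\<not> p ^ Suc M dvd dirichlet_mult F G (i0 * j0)"
    unfolding eq using r by (simp add: dvd_add_left_iff del: power_Suc)
  then show "dirichlet_mult F G (i0 * j0) \<noteq> 0"
    by auto
  have "p ^ M dvd F i0 * G j0"
    using M multiplicity_dvd by metis
  moreover have "p ^ M dvd r"
    using r by (rule dvd_trans[rotated]) (rule le_imp_power_dvd, simp)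
  ultimately have "p ^ M dvd dirichlet_mult F G (i0 * j0)"
    unfolding eq by simp
  then show "multiplicity p (dirichlet_mult F G (i0 * j0)) =
      multiplicity p (F i0) + multiplicity p (G j0)"
    unfolding M_def[symmetric] using ndvd by (rule multiplicity_eqI)
qed

section \<open>Newton polygons of the factors on a logarithmic scale\<close>

text \<open>Minimal weights of the factors add up to the minimal weight of the product, so
  \<open>F\<close> inherits the slope bound. The bound is multiplied out so that it also makes sense
  when the valuations do not increase.\<close>

lemma dirichlet_mult_top_minimal:
  fixes F G :: "nat \<Rightarrow> 'a::{factorial_semiring, idom}"
  assumes p: "prime_elem p"
    and F: "dsupp F \<subseteq> {m1..n1}" "F n1 \<noteq> 0" and G: "dsupp G \<subseteq> {m2..n2}" "G n2 \<noteq> 0"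
    and m1: "1 \<le> m1" "m1 < n1" and m2: "1 \<le> m2"
    and slope: "\<And>i. i < n1 * n2 \<Longrightarrow> dirichlet_mult F G i \<noteq> 0 \<Longrightarrow>
      (real (multiplicity p (dirichlet_mult F G (n1 * n2))) -
       real (multiplicity p (dirichlet_mult F G i))) * ln (real n1 / real m1)
        < ln (real (n1 * n2)) - ln (real i)"
  obtains j where "m2 \<le> j" "dirichlet_mult F G (n1 * j) \<noteq> 0"
    "\<And>i. dirichlet_mult F G i \<noteq> 0 \<Longrightarrow>
      multiplicity p (dirichlet_mult F G (n1 * j)) \<le> multiplicity p (dirichlet_mult F G i)"
proof -
  let ?H = "dirichlet_mult F G"
  define L where "L = ln (real n1 / real m1)"
  \<comment> \<open>The least index of minimal weight \<open>w\<close> is the vertex of the Newton polygon at which the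
    slopes reach \<open>1 / L\<close>; by the slope bound on the product it is the last index.\<close>
  define w where "w = (\<lambda>E i. L * real (multiplicity p (E i :: 'a)) - ln (real i))"
  have L: "L > 0"
    using m1 by (simp add: L_def)
  have finF: "finite (dsupp F)" "n1 \<in> dsupp F" and finG: "finite (dsupp G)" "n2 \<in> dsupp G"
    using F G finite_subset by (auto simp: dsupp_def)
  have posF: "m1 \<le> i" "i \<le> n1" "0 < i" if "F i \<noteq> 0" for i
    using that F(1) m1 by (force simp: dsupp_def)+
  have posG: "m2 \<le> i" "i \<le> n2" "0 < i" if "G i \<noteq> 0" for i
    using that G(1) m2 by (force simp: dsupp_def)+
  obtain i0 where i0: "i0 \<in> dsupp F" "\<And>i. i \<in> dsupp F \<Longrightarrow> w F i0 \<le> w F i"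
    "\<And>i. i \<in> dsupp F \<Longrightarrow> w F i = w F i0 \<Longrightarrow> i0 \<le> i"
    using ex_lex_min[OF finF(1), of "w F" "\<lambda>i. i"] finF(2) by blast
  obtain j0 where j0: "j0 \<in> dsupp G" "\<And>i. i \<in> dsupp G \<Longrightarrow> w G j0 \<le> w G i"
    "\<And>i. i \<in> dsupp G \<Longrightarrow> w G i = w G j0 \<Longrightarrow> j0 \<le> i"
    using ex_lex_min[OF finG(1), of "w G" "\<lambda>i. i"] finG(2) by blast
  have i0nz: "F i0 \<noteq> 0" and j0nz: "G j0 \<noteq> 0"
    using i0 j0 by (auto simp: dsupp_def)
  have i0pos: "0 < i0" and j0pos: "0 < j0"
    using posF posG i0nz j0nz by auto
  \<comment> \<open>For pairs with the same product the logarithms in the weights cancel, so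
    comparing weights amounts to comparing valuations.\<close>
  have "L * real (multiplicity p (F i0) + multiplicity p (G j0))
      < L * real (multiplicity p (F i) + multiplicity p (G j))"
    if ij: "F i \<noteq> 0" "G j \<noteq> 0" "i * j = i0 * j0" "(i, j) \<noteq> (i0, j0)" for i j
  proof -
    have mem: "i \<in> dsupp F" "j \<in> dsupp G" and pos: "0 < i" "0 < j"
      using ij posF posG by (auto simp: dsupp_def)
    have lnij: "ln (real i) + ln (real j) = ln (real i0) + ln (real j0)"
      using ij(3) pos i0pos j0pos by (metis ln_mult_pos of_nat_0_less_iff of_nat_mult)
    \<comment> \<open>Equal sums would make \<open>i\<close> and \<open>j\<close> minimisers too.
      Both \<open>i0\<close> and \<open>j0\<close> are the least ones, so the equal products would
      force the pairs to coincide.\<close>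
    have "w F i0 + w G j0 < w F i + w G j"
    proof (rule ccontr)
      assume "\<not> ?thesis"
      with i0(2)[OF mem(1)] j0(2)[OF mem(2)] have "w F i = w F i0" "w G j = w G j0"
        by auto
      then have "i0 \<le> i" "j0 \<le> j"
        using i0(3) j0(3) mem by auto
      then show False
        using mult_eq_mult_le_imp_eq[of i0 i j0 j] ij(3,4) i0pos j0pos by simp
    qed
    then show ?thesis
      using lnij by (simp add: w_def algebra_simps)
  qed
  then have "multiplicity p (F i0) + multiplicity p (G j0)
      < multiplicity p (F i) + multiplicity p (G j)"
    if "F i \<noteq> 0" "G j \<noteq> 0" "i * j = i0 * j0" "(i, j) \<noteq> (i0, j0)" for i j
    using that L by (metis mult_less_cancel_left_pos of_nat_less_iff)
  note isolated_ij = this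
  note term_ij = dirichlet_mult_isolated_term[of p F i0 G j0, OF p i0nz j0nz i0pos j0pos]
  have H0: "?H (i0 * j0) \<noteq> 0"
    by (rule term_ij(1)) (erule (3) isolated_ij)
  have H0_mult: "multiplicity p (?H (i0 * j0)) = multiplicity p (F i0) + multiplicity p (G j0)"
    by (rule term_ij(2)) (erule (3) isolated_ij)
  have top_unique: "i = n1 \<and> j = n2" if "F i \<noteq> 0" "G j \<noteq> 0" "n1 * n2 \<le> i * j" for i j
  proof (rule mult_eq_mult_le_imp_eq)
    show "i \<le> n1" "j \<le> n2" "0 < i" "0 < j"
      using that posF posG by blast+
    then show "i * j = n1 * n2"
      using that(3) mult_le_mono by (intro antisym)
  qed
  have Htop: "multiplicity p (?H (n1 * n2)) = multiplicity p (F n1) + multiplicity p (G n2)"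
  proof (rule dirichlet_mult_isolated_term(2)[of p F n1 G n2,
        OF p F(2) G(2) posF(3)[OF F(2)] posG(3)[OF G(2)]])
    fix i j
    assume "F i \<noteq> 0" "G j \<noteq> 0" "i * j = n1 * n2" "(i, j) \<noteq> (n1, n2)"
    then show "multiplicity p (F n1) + multiplicity p (G n2)
        < multiplicity p (F i) + multiplicity p (G j)"
      using top_unique[of i j] by simp
  qed
  \<comment> \<open>Otherwise the slope bound at \<open>i0 * j0\<close> would give the top pair a
    smaller weight than the minimum.\<close>
  have "n1 * n2 \<le> i0 * j0"
  proof (rule ccontr)
    assume "\<not> ?thesis"
    then have "i0 * j0 < n1 * n2"
      by simp
    from slope[OF this H0]
    have "(real (multiplicity p (F n1) + multiplicity p (G n2)) -
        real (multiplicity p (F i0) + multiplicity p (G j0))) * L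
          < ln (real (n1 * n2)) - ln (real (i0 * j0))"
      unfolding L_def H0_mult Htop .
    moreover have "ln (real (n1 * n2)) = ln (real n1) + ln (real n2)"
      "ln (real (i0 * j0)) = ln (real i0) + ln (real j0)"
      using posF(3)[OF F(2)] posG(3)[OF G(2)] i0pos j0pos by (simp_all add: ln_mult_pos)
    ultimately have "w F n1 + w G n2 < w F i0 + w G j0"
      by (simp add: w_def algebra_simps)
    with i0(2)[OF finF(2)] j0(2)[OF finG(2)] show False
      by simp
  qed
  then have i0n1: "i0 = n1"
    using top_unique i0nz j0nz by blast
  \<comment> \<open>Since \<open>n1\<close> is the least minimiser, any smaller index has strictly
    larger weight. As \<open>ln n1 - ln i\<close> is at most \<open>L\<close>, the valuation at
    \<open>n1\<close> is less than that at \<open>i\<close> plus 1, and integrality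
    concludes.\<close>
  have Fmin: "multiplicity p (F n1) \<le> multiplicity p (F i)" if nz: "F i \<noteq> 0" for i
  proof (cases "i = n1")
    case False
    have "w F n1 < w F i"
      using i0(2,3)[of i] nz posF(2)[OF nz] False unfolding i0n1
      by (auto simp: dsupp_def order.strict_iff_order)
    moreover have "ln (real m1) \<le> ln (real i)"
      using posF(1)[OF nz] m1 by simp
    moreover have "L = ln (real n1) - ln (real m1)"
      unfolding L_def using m1 by (simp add: ln_div)
    ultimately have "L * real (multiplicity p (F n1)) < L * real (multiplicity p (F i)) + L"
      unfolding w_def by linarith
    then have "L * real (multiplicity p (F n1)) < L * real (multiplicity p (F i) + 1)"
      by (simp add: distrib_left)
    then show ?thesis
      using L by simp
  qed simp
  obtain j where j: "j \<in> dsupp G"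
    "\<And>i. i \<in> dsupp G \<Longrightarrow> multiplicity p (G j) \<le> multiplicity p (G i)"
    "\<And>i. i \<in> dsupp G \<Longrightarrow> multiplicity p (G i) = multiplicity p (G j) \<Longrightarrow> - int j \<le> - int i"
    using ex_lex_min[OF finG(1), of "\<lambda>j. multiplicity p (G j)" "\<lambda>j. - int j"] finG(2) by blast
  have jnz: "G j \<noteq> 0"
    using j by (simp add: dsupp_def)
  have "multiplicity p (F n1) + multiplicity p (G j) < multiplicity p (F i) + multiplicity p (G l)"
    if il: "F i \<noteq> 0" "G l \<noteq> 0" "i * l = n1 * j" "(i, l) \<noteq> (n1, j)" for i l
  proof -
    \<comment> \<open>Since \<open>i\<close> cannot exceed \<open>n1\<close>, another pair with
      product \<open>n1 * j\<close> must have its second index beyond \<open>j\<close>, the last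
      index of minimal valuation in \<open>G\<close>.\<close>
    have "j < l"
    proof (rule ccontr)
      assume "\<not> ?thesis"
      then show False
        using mult_eq_mult_le_imp_eq[of i n1 l j] il(3,4) posF[OF il(1)] posG(3)[OF il(2)] by simp
    qed
    then have "multiplicity p (G j) < multiplicity p (G l)"
      using j(2,3)[of l] il(2) by (fastforce simp: dsupp_def)
    with Fmin[OF il(1)] show ?thesis
      by simp
  qed
  note isolated_j = this
  note term_j = dirichlet_mult_isolated_term[of p F n1 G j,
      OF p F(2) jnz posF(3)[OF F(2)] posG(3)[OF jnz]]
  have Hj: "?H (n1 * j) \<noteq> 0"
    by (rule term_j(1)) (erule (3) isolated_j)
  have Hj_mult: "multiplicity p (?H (n1 * j)) = multiplicity p (F n1) + multiplicity p (G j)"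
    by (rule term_j(2)) (erule (3) isolated_j)
  show thesis
  proof (rule that[OF posG(1)[OF jnz] Hj])
    fix i
    assume nz: "?H i \<noteq> 0"
    have "p ^ (multiplicity p (F n1) + multiplicity p (G j)) dvd ?H i"
      by (rule power_dvd_dirichlet_mult) (use Fmin j(2) in \<open>auto simp: dsupp_def add_mono\<close>)
    then show "multiplicity p (?H (n1 * j)) \<le> multiplicity p (?H i)"
      unfolding Hj_mult using nz p by (intro multiplicity_geI) (auto simp: prime_elem_def)
  qed
qed

section \<open>Extreme indices of a product\<close>

text \<open>Only one pair contributes at each of the extreme products \<open>m1 * m2\<close> and
  \<open>n1 * n2\<close>, so nothing cancels there, and a domain has no zero divisors.\<close>

lemma dirichlet_mult_support_bounds:
  fixes F G :: "nat \<Rightarrow> 'a::idom"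
  assumes F: "dsupp F \<subseteq> {m1..n1}" "F m1 \<noteq> 0" "F n1 \<noteq> 0"
    and G: "dsupp G \<subseteq> {m2..n2}" "G m2 \<noteq> 0" "G n2 \<noteq> 0"
    and m1: "0 < m1" and m2: "0 < m2"
    and H: "dsupp (dirichlet_mult F G) \<subseteq> {m..n}"
      "dirichlet_mult F G m \<noteq> 0" "dirichlet_mult F G n \<noteq> 0"
  shows "m1 * m2 = m" "n1 * n2 = n"
proof -
  let ?H = "dirichlet_mult F G"
  have only: "?H (i0 * j0) = F i0 * G j0"
    if "0 < i0" "0 < j0"
      "\<And>i j. F i \<noteq> 0 \<Longrightarrow> G j \<noteq> 0 \<Longrightarrow> i * j = i0 * j0 \<Longrightarrow> i = i0 \<and> j = j0" for i0 j0
  proof -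
    have "?H (i0 * j0) = (\<Sum>(j, k)\<in>{(i0, j0)}. F j * G k)"
      unfolding dirichlet_mult_def
      by (rule sum.mono_neutral_right[OF finite_factor_pairs]) (use that in auto)
    then show ?thesis
      by simp
  qed
  have bF: "m1 \<le> i" "i \<le> n1" if "F i \<noteq> 0" for i
    using that F by (auto simp: dsupp_def)
  have bG: "m2 \<le> i" "i \<le> n2" if "G i \<noteq> 0" for i
    using that G by (auto simp: dsupp_def)
  have bH: "m \<le> i" "i \<le> n" if "?H i \<noteq> 0" for i
    using that H by (auto simp: dsupp_def)
  have n12: "0 < n1" "0 < n2"
    using bF[OF F(3)] bG[OF G(3)] m1 m2 by linarith+
  have "?H (m1 * m2) = F m1 * G m2"
  proof (rule only[OF m1 m2])
    fix i j
    assume "F i \<noteq> 0" "G j \<noteq> 0" "i * j = m1 * m2"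
    then show "i = m1 \<and> j = m2"
      using mult_eq_mult_le_imp_eq[of m1 i m2 j] bF bG m1 m2 by auto
  qed
  then have "m \<le> m1 * m2"
    using bH F G by simp
  moreover obtain i j where "F i \<noteq> 0" "G j \<noteq> 0" "i * j = m"
    using H(2) by (rule dirichlet_mult_nonzeroE)
  then have "m1 * m2 \<le> m"
    using bF bG mult_le_mono by blast
  ultimately show "m1 * m2 = m"
    by simp
  have "?H (n1 * n2) = F n1 * G n2"
  proof (rule only[OF n12])
    fix i j
    assume *: "F i \<noteq> 0" "G j \<noteq> 0" "i * j = n1 * n2"
    then show "i = n1 \<and> j = n2"
      using mult_eq_mult_le_imp_eq[of i n1 j n2] bF(1)[OF *(1)] bF(2)[OF *(1)] bG(1)[OF *(2)] bG(2)[OF *(2)] m1 m2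
      by auto
  qed
  then have "n1 * n2 \<le> n"
    using bH F G by simp
  moreover obtain i j where "F i \<noteq> 0" "G j \<noteq> 0" "i * j = n"
    using H(3) by (rule dirichlet_mult_nonzeroE)
  then have "n \<le> n1 * n2"
    using bF bG mult_le_mono by blast
  ultimately show "n1 * n2 = n"
    by simp
qed

section \<open>Clearing denominators and bounding supports\<close>

lemma ex_fract_denominator: "\<exists>d. d \<noteq> 0 \<and> (\<exists>y. to_fract d * x = to_fract y)"
proof (cases x rule: Fract_cases)
  case (Fract a b)
  then have "to_fract b * x = to_fract a"
    by (simp add: Fract_conv_to_fract)
  with Fract show ?thesis
    by blast
qed

text \<open>The product of the denominators over the finite support works. This moves a
  factorization from the quotient field into the ring, where \<open>multiplicity p\<close> is
  meaningful.\<close>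

lemma ex_common_denominator:
  fixes u :: "nat \<Rightarrow> 'a::idom fract"
  assumes "finite (dsupp u)"
  obtains d U where "d \<noteq> 0" "\<And>i. to_fract (U i) = to_fract d * u i"
proof -
  obtain e where e: "e i \<noteq> 0" "\<exists>y. to_fract (e i) * u i = to_fract y" for i
    using ex_fract_denominator[of "u _"] by metis
  define d where "d = (\<Prod>i\<in>dsupp u. e i)"
  have "\<exists>y. to_fract y = to_fract d * u i" for i
  proof (cases "i \<in> dsupp u")
    case True
    then have "d = e i * (\<Prod>i\<in>dsupp u - {i}. e i)"
      unfolding d_def using assms by (rule prod.remove[rotated])
    moreover obtain y where "to_fract (e i) * u i = to_fract y"
      using e by blast
    ultimately have "to_fract d * u i = to_fract (y * (\<Prod>i\<in>dsupp u - {i}. e i))"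
      by (simp add: mult_ac)
    then show ?thesis
      by metis
  qed (auto simp: dsupp_def intro: exI[of _ 0])
  moreover have "d \<noteq> 0"
    unfolding d_def using assms e(1) by simp
  ultimately show thesis
    using that by metis
qed

text \<open>A single term with index above 1 is nonconstant, so \<open>l = r\<close> can occur. Only
  the upper end is certain to exceed 1.\<close>

lemma nonconstant_support_bounds:
  assumes "dirichlet_poly u" "\<not> dconstant u"
  obtains l r where "0 < l" "l \<le> r" "1 < r" "u l \<noteq> 0" "u r \<noteq> 0" "dsupp u \<subseteq> {l..r}"
proof -
  have fin: "finite (dsupp u)" and ne: "dsupp u \<noteq> {}" and zero: "0 \<notin> dsupp u"
    using assms by (auto simp: dirichlet_poly_def dconstant_def)
  obtain i where "i \<in> dsupp u" "i \<noteq> 1"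
    using assms by (auto simp: dconstant_def)
  then have "1 < i" "i \<le> Max (dsupp u)"
    using zero fin by (auto intro: gr0I Suc_lessI)
  moreover have "Min (dsupp u) \<in> dsupp u" "Max (dsupp u) \<in> dsupp u"
    using fin ne by simp_all
  moreover from this have "0 < Min (dsupp u)" "Min (dsupp u) \<le> Max (dsupp u)"
    using zero fin by (auto intro!: gr0I)
  moreover have "dsupp u \<subseteq> {Min (dsupp u)..Max (dsupp u)}"
    using fin by auto
  ultimately show thesis
    using that[of "Min (dsupp u)" "Max (dsupp u)"] by (simp add: dsupp_def)
qed

section \<open>Admissible quotients of divisors\<close>

lemma delta_le:
  assumes "d dvd n" "c dvd m" "c < d" "0 < c" "0 < m" "0 < n"
  shows "delta m n \<le> real d / real c"
  unfolding delta_def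
proof (rule Min_le)
  show "finite {real d / real c |d c. d dvd n \<and> c dvd m \<and> c < d \<and> 0 < c}"
    by (rule finite_subset[of _ "(\<lambda>(d, c). real d / real c) ` ({..n} \<times> {..m})"])
      (use assms in \<open>force dest: dvd_imp_le\<close>, simp)
qed (use assms in blast)

lemma le_rho:
  assumes "d dvd n" "c dvd m" "real d / real c \<le> sqrt (real n / real m)" "0 < m" "0 < n"
  shows "real d / real c \<le> rho m n"
  unfolding rho_def
proof (rule Max_ge)
  show "finite {real d / real c |d c. d dvd n \<and> c dvd m \<and> real d / real c \<le> sqrt (real n / real m)}"
    by (rule finite_subset[of _ "(\<lambda>(d, c). real d / real c) ` ({..n} \<times> {..m})"])
      (use assms in \<open>force dest: dvd_imp_le\<close>, simp)
qed (use assms in blast)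

section \<open>The irreducibility criterion\<close>

theorem theorem4p2:
  fixes a b :: "nat \<Rightarrow> 'a :: {factorial_semiring, idom}"
    and p :: 'a and m n k :: nat
  assumes "1 \<le> m" and "m < n"
    and "dsupp a \<subseteq> {m..n}" and "a m \<noteq> 0" and "a n \<noteq> 0"
    and "algebraically_primitive a"
    and "prime_elem p"
    and "real k < real m * delta m n" and "\<not> p dvd a k"
    and "\<And>j. real j \<ge> real m * delta m n \<Longrightarrow> p dvd a j"
    and "\<And>i. i < n \<Longrightarrow> nu p (a i) < nu p (a n) \<Longrightarrow>
           rho m n < (real n / real i) powr (1 / real (the_enat (nu p (a n) - nu p (a i))))"
    and "\<And>i. i \<in> {m..n} \<Longrightarrow> b i \<noteq> 0"
    and "\<not> p dvd b k * b n"
  shows "irreducible_over_quotient_field (\<lambda>i. a i * b i)"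
proof -
  have supp: "i \<in> {m..n}" "b i \<noteq> 0" if "a i \<noteq> 0" for i
    using that assms(3,12) by (auto simp: dsupp_def)
  have mn: "0 < m" "0 < n"
    using assms(1,2) by auto
  have nunit: "\<not> is_unit p"
    using assms(7) by (simp add: prime_elem_def)
  have pb: "\<not> p dvd b k" "\<not> p dvd b n"
    using assms(13) by auto
  have ak: "a k \<noteq> 0"
    using assms(9) by auto
  \<comment> \<open>This holds for either factor of a factorization. Applying it to both replaces
    the choice of the one with the smaller ratio.\<close>
  have key: "m1 * m2 = m \<and> n1 * n2 = n \<and> sqrt (real n / real m) < real n1 / real m1"
    if u: "dirichlet_poly u" "0 < m1" "m1 \<le> n1" "1 < n1" "u m1 \<noteq> 0" "u n1 \<noteq> 0"
        "dsupp u \<subseteq> {m1..n1}"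
      and v: "dirichlet_poly v" "0 < m2" "v m2 \<noteq> 0" "v n2 \<noteq> 0" "dsupp v \<subseteq> {m2..n2}"
      and uv: "(\<lambda>i. to_fract (a i * b i)) = dirichlet_mult u v"
    for u v m1 n1 m2 n2
  proof -
    obtain d U where U: "d \<noteq> 0" "\<And>i. to_fract (U i) = to_fract d * u i"
      using u(1) unfolding dirichlet_poly_def by (metis ex_common_denominator)
    obtain e V where V: "e \<noteq> 0" "\<And>i. to_fract (V i) = to_fract e * v i"
      using v(1) unfolding dirichlet_poly_def by (metis ex_common_denominator)
    have U0: "U i = 0 \<longleftrightarrow> u i = 0" for i
      using U by (metis mult_eq_0_iff to_fract_eq_0_iff)
    have V0: "V i = 0 \<longleftrightarrow> v i = 0" for i
      using V by (metis mult_eq_0_iff to_fract_eq_0_iff)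
    have suppU: "dsupp U \<subseteq> {m1..n1}" "U m1 \<noteq> 0" "U n1 \<noteq> 0"
      and suppV: "dsupp V \<subseteq> {m2..n2}" "V m2 \<noteq> 0" "V n2 \<noteq> 0"
      using u v by (simp_all add: U0 V0 dsupp_def)
    \<comment> \<open>Over the ring, \<open>U\<close> and \<open>V\<close> factor \<open>c\<close>
      times the given polynomial. The constant \<open>c\<close> shifts all valuations equally and
      leaves the slopes unchanged.\<close>
    define c where "c = d * e"
    have c: "c \<noteq> 0"
      using U V by (simp add: c_def)
    have H: "dirichlet_mult U V i = c * (a i * b i)" for i
    proof -
      have "to_fract (dirichlet_mult U V i) = to_fract c * dirichlet_mult u v i"
        unfolding dirichlet_mult_def sum_distrib_left
        by (auto simp: U V c_def mult_ac intro!: sum.cong)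
      also have "\<dots> = to_fract (c * (a i * b i))"
        using fun_cong[OF uv, of i] by simp
      finally show ?thesis
        by (simp only: to_fract_eq_iff)
    qed
    have H0: "dirichlet_mult U V i \<noteq> 0 \<longleftrightarrow> a i \<noteq> 0" for i
      using c supp by (auto simp: H)
    have suppH: "dsupp (dirichlet_mult U V) \<subseteq> {m..n}"
      using assms(3) H0 by (auto simp: dsupp_def)
    have prods: "m1 * m2 = m" "n1 * n2 = n"
      using dirichlet_mult_support_bounds[OF suppU suppV u(2) v(2) suppH] H0 assms(4,5) by auto
    \<comment> \<open>If \<open>u\<close> had a single term, its index, which exceeds 1, would
      divide every index in the support of \<open>a\<close>.\<close>
    have m1n1: "m1 < n1"
    proof (rule ccontr)
      assume "\<not> m1 < n1"
      then have "n1 = m1"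
        using u(3) by simp
      have "m1 dvd i" if "i \<in> dsupp a" for i
      proof -
        have "dirichlet_mult U V i \<noteq> 0"
          using that H0 by (simp add: dsupp_def)
        then obtain j l where "U j \<noteq> 0" "V l \<noteq> 0" "j * l = i"
          by (rule dirichlet_mult_nonzeroE)
        then show ?thesis
          using suppU(1) \<open>n1 = m1\<close> by (auto simp: dsupp_def)
      qed
      then have "m1 dvd Gcd (dsupp a)"
        by (rule Gcd_greatest)
      then show False
        using assms(6) u(4) \<open>n1 = m1\<close> by (simp add: algebraically_primitive_def)
    qed
    have "\<not> real n1 / real m1 \<le> sqrt (real n / real m)"
    proof
      assume "real n1 / real m1 \<le> sqrt (real n / real m)"
      then have rho: "real n1 / real m1 \<le> rho m n"
        using prods mn by (intro le_rho) auto
      have ratio: "1 < real n1 / real m1"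
        using m1n1 u(2) by simp
      have mult: "multiplicity p (dirichlet_mult U V i) =
          multiplicity p c + multiplicity p (a i) + multiplicity p (b i)" if "a i \<noteq> 0" for i
        using that supp[OF that] c assms(7) by (simp add: H prime_elem_multiplicity_mult_distrib)
      have slope: "(real (multiplicity p (dirichlet_mult U V (n1 * n2))) -
          real (multiplicity p (dirichlet_mult U V i))) * ln (real n1 / real m1)
            < ln (real (n1 * n2)) - ln (real i)"
        if i: "i < n1 * n2" "dirichlet_mult U V i \<noteq> 0" for i
      proof -
        have ai: "a i \<noteq> 0" and "i < n"
          using i H0 prods by auto
        then have ipos: "0 < i"
          using supp(1)[OF ai] mn by auto
        let ?N = "real (multiplicity p (a n)) - real (multiplicity p (a i))"
        have "?N * ln (real n1 / real m1) < ln (real n) - ln (real i)"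
        \<comment> \<open>If the valuation rises from \<open>i\<close> to \<open>n\<close>, the
          claim is the logarithm of the hypothesis on \<open>rho\<close>. Otherwise the left side is
          at most 0 and the right side is positive.\<close>
        proof (cases "multiplicity p (a i) < multiplicity p (a n)")
          case True
          then have "rho m n < (real n / real i) powr (1 / ?N)"
            using assms(11)[of i] \<open>i < n\<close> ai assms(5) by (simp add: nu_def of_nat_diff)
          then have "ln (real n1 / real m1) < ln ((real n / real i) powr (1 / ?N))"
            using rho ratio ipos mn by (subst ln_less_cancel_iff) auto
          also have "\<dots> = (ln (real n) - ln (real i)) / ?N"
            using ipos mn by (simp add: ln_powr ln_div)
          finally show ?thesis
            using True by (simp add: pos_less_divide_eq mult.commute)
        next
          case False
          then have "?N * ln (real n1 / real m1) \<le> 0"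
            using ratio by (intro mult_nonpos_nonneg) auto
          also have "0 < ln (real n) - ln (real i)"
            using ipos \<open>i < n\<close> by simp
          finally show ?thesis .
        qed
        \<comment> \<open>The valuation of \<open>c\<close> cancels, that of \<open>b n\<close> is
          0, and that of \<open>b i\<close> only lowers the difference.\<close>
        moreover have "real (multiplicity p (dirichlet_mult U V (n1 * n2))) -
            real (multiplicity p (dirichlet_mult U V i)) \<le> ?N"
          using mult[OF ai] mult[OF assms(5)] pb(2) prods(2)
          by (simp add: not_dvd_imp_multiplicity_0)
        then have "(real (multiplicity p (dirichlet_mult U V (n1 * n2))) -
            real (multiplicity p (dirichlet_mult U V i))) * ln (real n1 / real m1)
              \<le> ?N * ln (real n1 / real m1)"
          using ratio by (intro mult_right_mono) auto
        ultimately show ?thesis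
          using prods(2) by simp
      qed
      obtain j where j: "m2 \<le> j" "dirichlet_mult U V (n1 * j) \<noteq> 0"
        "\<And>i. dirichlet_mult U V i \<noteq> 0 \<Longrightarrow>
          multiplicity p (dirichlet_mult U V (n1 * j)) \<le> multiplicity p (dirichlet_mult U V i)"
        by (rule dirichlet_mult_top_minimal[OF assms(7) suppU(1,3) suppV(1,3) _ m1n1 _ slope])
          (use u(2) v(2) in auto)
      have anj: "a (n1 * j) \<noteq> 0"
        using j(2) H0 by simp
      \<comment> \<open>The coefficient at \<open>k\<close> has the valuation of \<open>c\<close>, a
        lower bound for all of them. The minimal coefficient at \<open>n1 * j\<close> must attain it
        too.\<close>
      have "multiplicity p (dirichlet_mult U V k) = multiplicity p c"
        using mult[OF ak] assms(9) pb(1) by (simp add: not_dvd_imp_multiplicity_0)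
      then have "multiplicity p (a (n1 * j)) = 0"
        using j(3)[of k] H0 ak mult[OF anj] by simp
      then have "\<not> p dvd a (n1 * j)"
        using anj nunit by (simp add: multiplicity_eq_zero_iff)
      moreover have "real m * delta m n \<le> real m * (real n1 / real m1)"
        using prods mn m1n1 u(2) by (intro mult_left_mono delta_le) auto
      moreover have "\<dots> = real (n1 * m2)"
        using u(2) by (simp flip: prods(1))
      moreover have "\<dots> \<le> real (n1 * j)"
        using j(1) by (simp del: of_nat_mult)
      ultimately show False
        using assms(10)[of "n1 * j"] by linarith
    qed
    then show ?thesis
      using prods by simp
  qed
  show ?thesis
    unfolding irreducible_over_quotient_field_def
  proof (rule notI, elim exE conjE)
    fix u v :: "nat \<Rightarrow> 'a fract"
    assume u: "dirichlet_poly u" "\<not> dconstant u" and v: "dirichlet_poly v" "\<not> dconstant v"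
      and uv: "(\<lambda>i. to_fract (a i * b i)) = dirichlet_mult u v"
    obtain m1 n1 where b1: "0 < m1" "m1 \<le> n1" "1 < n1" "u m1 \<noteq> 0" "u n1 \<noteq> 0" "dsupp u \<subseteq> {m1..n1}"
      using u by (rule nonconstant_support_bounds)
    obtain m2 n2 where b2: "0 < m2" "m2 \<le> n2" "1 < n2" "v m2 \<noteq> 0" "v n2 \<noteq> 0" "dsupp v \<subseteq> {m2..n2}"
      using v by (rule nonconstant_support_bounds)
    have k1: "m1 * m2 = m" "n1 * n2 = n" "sqrt (real n / real m) < real n1 / real m1"
      using key[OF u(1) b1 v(1) b2(1,4-6) uv] by auto
    have k2: "sqrt (real n / real m) < real n2 / real m2"
      using key[OF v(1) b2 u(1) b1(1,4-6)] uv by (simp add: dirichlet_mult_commute[of v u])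
    \<comment> \<open>Both ratios exceed the square root of \<open>n / m\<close>, yet their product
      is exactly \<open>n / m\<close>.\<close>
    have "sqrt (real n / real m) * sqrt (real n / real m) < (real n1 / real m1) * (real n2 / real m2)"
      using k1(3) k2 by (intro mult_strict_mono') auto
    then show False
      by (simp flip: k1(1,2))
  qed
qed

end
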